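(* Let $X|\mu\sim p_X(x-\mu)$ and $Y|\mu\sim q(y-\mu)$ be independent, $x,y,\mu\in\mathbb{R}^p$, with $p_X$ and $q$ known densities on $\mathbb{R}^p$ and $\mu$ unknown. The minimum risk equivariant estimator of $q(y-\mu)$, $y\in\mathbb{R}^p$, under integrated $L_2$ loss is given by $$\hat q_{\rm mre}(y;x)=q*\bar p_X(y-x),$$ with $\bar p_X(t)=p_X(-t)$ for all $t$, and it matches the Bayes predictive density with respect to the uniform prior $\pi(\mu)=1$ on $\mathbb{R}^p$. Furthermore, $\hat q_{\rm mre}(\cdot;X)$ is a minimax predictive density estimator.
   Context: The integrated $L_2$ loss of a predictive density estimate $\hat q(\cdot;x)$ is $\int_{\mathbb{R}^p}(q(y-\mu)-\hat q(y;x))^2\,dy$; the risk $R(\mu,\hat q)$ is its expectation over $X$. An estimator is equivariant (under $(x,y)\to(x+a,y+a)$, $a\in\mathbb{R}^p$) if $\hat q(y;x)=\hat q(y-x;0)$ for all $x,y\in\mathbb{R}^p$; such estimators have constant risk in $\mu$, and the minimum risk equivariant estimator is the one with smallest risk. The convolution is $q*g(t)=\int_{\mathbb{R}^p}q(t-u)g(u)\,du$. The Bayes predictive density for a posterior density $\pi(\mu|x)$ is $\int_{\mathbb{R}^p}q(y-\mu)\,\pi(\mu|x)\,d\mu$; for the uniform prior the posterior density is $\pi(\mu|x)=p_X(x-\mu)$. An estimator is minimax if it minimizes $\sup_\mu R(\mu,\hat q)$ over all predictive density estimators. *)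

theory Defs
  imports "HOL-Probability.Probability"
begin

definition prob_density :: "(real ^ 'p \<Rightarrow> real) \<Rightarrow> bool" where
  "prob_density f \<longleftrightarrow> f \<in> borel_measurable borel \<and> (\<forall>t. 0 \<le> f t) \<and>
     (\<integral>\<^sup>+ t. ennreal (f t) \<partial>lborel) = 1"

text \<open>
  A statistical model: a family of probability measures \<open>M \<mu>\<close> indexed by the location
  parameter, carrying fixed observables \<open>X\<close> and \<open>Y\<close>.
\<close>

definition location_model ::
  "(real ^ 'p \<Rightarrow> 'w measure) \<Rightarrow> ('w \<Rightarrow> real ^ 'p) \<Rightarrow> ('w \<Rightarrow> real ^ 'p)
     \<Rightarrow> (real ^ 'p \<Rightarrow> real) \<Rightarrow> (real ^ 'p \<Rightarrow> real) \<Rightarrow> bool" where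
  "location_model M X Y pX q \<longleftrightarrow> (\<forall>\<mu>.
     prob_space (M \<mu>) \<and>
     distributed (M \<mu>) lborel X (\<lambda>x. ennreal (pX (x - \<mu>))) \<and>
     distributed (M \<mu>) lborel Y (\<lambda>y. ennreal (q (y - \<mu>))) \<and>
     prob_space.indep_var (M \<mu>) borel X borel Y)"

text \<open>
  Estimators are written with the argument order of \<open>qhat(y; x)\<close>: the point \<open>y\<close> at which the
  density is evaluated first, the observation \<open>x\<close> second.
\<close>

definition predictive_density_estimator :: "(real ^ 'p \<Rightarrow> real ^ 'p \<Rightarrow> real) \<Rightarrow> bool" where
  "predictive_density_estimator qhat \<longleftrightarrow>
     (\<lambda>(y, x). qhat y x) \<in> borel_measurable (borel \<Otimes>\<^sub>M borel) \<and>
     (\<forall>x. prob_density (\<lambda>y. qhat y x))"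

text \<open>
  Loss and risk take values in \<open>[0, \<infinity>]\<close>, since \<open>q\<close> and the estimators need not be
  square integrable.
\<close>

definition L2_loss ::
  "(real ^ 'p \<Rightarrow> real) \<Rightarrow> real ^ 'p \<Rightarrow> (real ^ 'p \<Rightarrow> real ^ 'p \<Rightarrow> real) \<Rightarrow> real ^ 'p \<Rightarrow> ennreal" where
  "L2_loss q \<mu> qhat x = (\<integral>\<^sup>+ y. ennreal ((q (y - \<mu>) - qhat y x)\<^sup>2) \<partial>lborel)"

definition risk ::
  "(real ^ 'p \<Rightarrow> 'w measure) \<Rightarrow> ('w \<Rightarrow> real ^ 'p) \<Rightarrow> (real ^ 'p \<Rightarrow> real)
     \<Rightarrow> real ^ 'p \<Rightarrow> (real ^ 'p \<Rightarrow> real ^ 'p \<Rightarrow> real) \<Rightarrow> ennreal" where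
  "risk M X q \<mu> qhat = (\<integral>\<^sup>+ \<omega>. L2_loss q \<mu> qhat (X \<omega>) \<partial>M \<mu>)"

definition equivariant :: "(real ^ 'p \<Rightarrow> real ^ 'p \<Rightarrow> real) \<Rightarrow> bool" where
  "equivariant qhat \<longleftrightarrow> (\<forall>x y. qhat y x = qhat (y - x) 0)"

text \<open>
  Equivariant estimators have constant risk, so comparing risks at every \<open>\<mu>\<close> is the same as
  comparing the constants.
\<close>

definition min_risk_equivariant ::
  "(real ^ 'p \<Rightarrow> 'w measure) \<Rightarrow> ('w \<Rightarrow> real ^ 'p) \<Rightarrow> (real ^ 'p \<Rightarrow> real)
     \<Rightarrow> (real ^ 'p \<Rightarrow> real ^ 'p \<Rightarrow> real) \<Rightarrow> bool" where
  "min_risk_equivariant M X q qhat \<longleftrightarrow>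
     predictive_density_estimator qhat \<and> equivariant qhat \<and>
     (\<forall>qhat'. predictive_density_estimator qhat' \<and> equivariant qhat' \<longrightarrow>
        (\<forall>\<mu>. risk M X q \<mu> qhat \<le> risk M X q \<mu> qhat'))"

definition minimax ::
  "(real ^ 'p \<Rightarrow> 'w measure) \<Rightarrow> ('w \<Rightarrow> real ^ 'p) \<Rightarrow> (real ^ 'p \<Rightarrow> real)
     \<Rightarrow> (real ^ 'p \<Rightarrow> real ^ 'p \<Rightarrow> real) \<Rightarrow> bool" where
  "minimax M X q qhat \<longleftrightarrow>
     predictive_density_estimator qhat \<and>
     (\<forall>qhat'. predictive_density_estimator qhat' \<longrightarrow>
        (SUP \<mu>. risk M X q \<mu> qhat) \<le> (SUP \<mu>. risk M X q \<mu> qhat'))"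

definition conv :: "(real ^ 'p \<Rightarrow> real) \<Rightarrow> (real ^ 'p \<Rightarrow> real) \<Rightarrow> real ^ 'p \<Rightarrow> real" where
  "conv f g t = (\<integral> u. f (t - u) * g u \<partial>lborel)"

definition q_mre ::
  "(real ^ 'p \<Rightarrow> real) \<Rightarrow> (real ^ 'p \<Rightarrow> real) \<Rightarrow> real ^ 'p \<Rightarrow> real ^ 'p \<Rightarrow> real" where
  "q_mre q pX y x = conv q (\<lambda>t. pX (- t)) (y - x)"

text \<open>
  The posterior density of \<open>\<mu>\<close> given \<open>x\<close> for a (possibly improper) prior density, by
  Bayes' formula.
\<close>

definition posterior ::
  "(real ^ 'p \<Rightarrow> real) \<Rightarrow> (real ^ 'p \<Rightarrow> real) \<Rightarrow> real ^ 'p \<Rightarrow> real ^ 'p \<Rightarrow> real" where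
  "posterior prior pX x \<mu> =
     prior \<mu> * pX (x - \<mu>) / (\<integral> \<nu>. prior \<nu> * pX (x - \<nu>) \<partial>lborel)"

definition bayes_predictive ::
  "(real ^ 'p \<Rightarrow> real) \<Rightarrow> (real ^ 'p \<Rightarrow> real ^ 'p \<Rightarrow> real) \<Rightarrow> real ^ 'p \<Rightarrow> real ^ 'p \<Rightarrow> real" where
  "bayes_predictive q post y x = (\<integral> \<mu>. q (y - \<mu>) * post x \<mu> \<partial>lborel)"

lemma lborel_distr_reflect:
  fixes x :: "real ^ 'p"
  shows "distr lborel borel (\<lambda>u. x - u) = lborel"
  using lborel_affine[of "-1" x] by (simp add: density_1)

lemma posterior_uniform:
  assumes "prob_density pX"
  shows "posterior (\<lambda>_. 1) pX x \<mu> = pX (x - \<mu>)"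
proof -
  have [measurable]: "pX \<in> borel_measurable borel"
    and nn: "\<And>t. 0 \<le> pX t" and one: "(\<integral>\<^sup>+ t. ennreal (pX t) \<partial>lborel) = 1"
    using assms by (auto simp: prob_density_def)
  have "(\<integral> \<nu>. pX (x - \<nu>) \<partial>lborel) = (\<integral> t. pX t \<partial>distr lborel borel (\<lambda>u. x - u))"
    by (subst integral_distr) auto
  also have "\<dots> = (\<integral> t. pX t \<partial>lborel)"
    by (simp add: lborel_distr_reflect)
  also have "\<dots> = 1"
    using nn one by (subst integral_eq_nn_integral) auto
  finally show ?thesis by (simp add: posterior_def)
qed

end

theory Submission
  imports Defs "HOL-Real_Asymp.Real_Asymp"
begin

text \<open>
  Fix the displacement \<open>t = y - x\<close> and regard \<open>u = \<mu> - x\<close> as random with density \<open>pX (- u)\<close>. The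
  quantity to be estimated at \<open>y\<close> is then \<open>q (y - \<mu>) = q (t - u)\<close>, and the constant closest to a
  random variable in mean square is its expectation, which here is the convolution
  \<open>conv q (\<lambda>u. pX (- u)) t\<close>. An equivariant estimator uses one constant for each \<open>t\<close>, so by Fubini
  its risk is the integral over \<open>t\<close> of this mean square error
  (\<open>risk_equivariant\<close>). Every other choice adds the squared \<open>L\<^sub>2\<close> distance to the
  convolution (\<open>risk_equivariant_decomposition\<close>); this gives both optimality and, for finite risk,
  uniqueness almost everywhere. The same constant is the mean of \<open>q (y - \<mu>)\<close> under the uniform-prior
  posterior, whence the Bayes representation.

  For minimaxity, the maximal risk dominates the average risk under the uniform prior on a ball of
  radius \<open>r + k\<close>. When \<open>x\<close> lies within distance \<open>r\<close> of the
  origin, this prior charges every \<open>\<mu>\<close> with \<open>norm (\<mu> - x) < k\<close>,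
  so that the unnormalised posterior error at \<open>x\<close>, integrated over \<open>y\<close>,
  is at least the integral over \<open>t\<close> of the minimal mean square error for the weight
  \<open>pX (- u)\<close> restricted to the ball of radius \<open>k\<close>, whatever the
  estimator (\<open>averaged_risk_lower_bound\<close>). Letting \<open>r\<close> tend to infinity
  with \<open>k\<close> fixed, the ratio of the volumes of the two balls tends to one, and the
  bound becomes independent of \<open>r\<close> (\<open>le_of_ball_emeasure_le\<close>). Finally
  \<open>k\<close> tends to infinity, and two applications of Fatou's lemma recover the full risk
  of the equivariant estimator (\<open>truncated_sq_error_liminf\<close>,
  \<open>risk_q_mre_le_sup_risk\<close>).

  All errors and risks take values in \<open>[0, \<infinity>]\<close>, and Fatou's lemma gives the lower bound also
  when the risk of the equivariant estimator is infinite.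
\<close>

section \<open>Quadratic error around a weighted mean\<close>

text \<open>
  The bias-variance identity with values in \<open>[0, \<infinity>]\<close>. The integrands on the two sides differ
  by an affine function of \<open>Z\<close> times \<open>w\<close>, which is integrable; hence when the second moment diverges,
  both sides are infinite. The mean \<open>m\<close> is specified by a product instead of a quotient so that
  the weight may vanish.
\<close>

lemma nn_integral_sq_decomposition:
  fixes w Z :: "'a \<Rightarrow> real"
  assumes [measurable]: "w \<in> borel_measurable N" "Z \<in> borel_measurable N"
    and nonneg: "\<And>u. 0 \<le> w u"
    and int_w: "integrable N w" and int_Z: "integrable N (\<lambda>u. Z u * w u)"
    and mean: "(\<integral>u. Z u * w u \<partial>N) = m * (\<integral>u. w u \<partial>N)"
  shows "(\<integral>\<^sup>+u. ennreal (w u * (Z u - c)\<^sup>2) \<partial>N) =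
    (\<integral>\<^sup>+u. ennreal (w u * (Z u - m)\<^sup>2) \<partial>N) + ennreal ((\<integral>u. w u \<partial>N) * (m - c)\<^sup>2)"
proof -
  define g where "g = (\<lambda>u. 2 * (m - c) * (Z u * w u) - 2 * (m - c) * m * w u + (m - c)\<^sup>2 * w u)"
  have expand: "w u * (Z u - c)\<^sup>2 = w u * (Z u - m)\<^sup>2 + g u" for u
    by (simp add: g_def power2_eq_square algebra_simps)
  have int_g: "integrable N g"
    unfolding g_def using int_w int_Z by (intro Bochner_Integration.integrable_add
        Bochner_Integration.integrable_diff integrable_mult_right) auto
  have g_val: "(\<integral>u. g u \<partial>N) = (\<integral>u. w u \<partial>N) * (m - c)\<^sup>2"
    unfolding g_def using int_w int_Z by (simp add: mean)
  show ?thesis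
  proof (cases "integrable N (\<lambda>u. w u * (Z u - m)\<^sup>2)")
    case True
    have int_c: "integrable N (\<lambda>u. w u * (Z u - c)\<^sup>2)"
      unfolding expand using True int_g by simp
    have "(\<integral>u. w u * (Z u - c)\<^sup>2 \<partial>N) =
        (\<integral>u. w u * (Z u - m)\<^sup>2 \<partial>N) + (\<integral>u. w u \<partial>N) * (m - c)\<^sup>2"
      unfolding expand using True int_g g_val by simp
    then show ?thesis
      using True int_c nonneg by (simp add: nn_integral_eq_integral ennreal_plus integral_nonneg)
  next
    case False
    have "\<not> integrable N (\<lambda>u. w u * (Z u - c)\<^sup>2)"
    proof
      assume "integrable N (\<lambda>u. w u * (Z u - c)\<^sup>2)"
      then have "integrable N (\<lambda>u. w u * (Z u - c)\<^sup>2 - g u)"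
        using int_g by simp
      then show False using False by (simp add: expand)
    qed
    moreover have "(\<integral>\<^sup>+u. ennreal (w u * (Z u - d)\<^sup>2) \<partial>N) = \<infinity>"
      if "\<not> integrable N (\<lambda>u. w u * (Z u - d)\<^sup>2)" for d
    proof (rule ccontr)
      assume "(\<integral>\<^sup>+u. ennreal (w u * (Z u - d)\<^sup>2) \<partial>N) \<noteq> \<infinity>"
      then have "integrable N (\<lambda>u. w u * (Z u - d)\<^sup>2)"
        using nonneg by (intro integrableI_nonneg) (simp_all add: less_top)
      then show False using that by contradiction
    qed
    ultimately show ?thesis using False by simp
  qed
qed

text \<open>
  The weight is a parameter because the density \<open>pX (- u)\<close> is needed both in full, for the risk of
  equivariant estimators, and truncated to balls, for the lower bound on the maximal risk.
\<close>

definition weighted_sq_error ::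
  "(real ^ 'p \<Rightarrow> real) \<Rightarrow> (real ^ 'p \<Rightarrow> real) \<Rightarrow> real ^ 'p \<Rightarrow> real \<Rightarrow> ennreal" where
  "weighted_sq_error w q t c = (\<integral>\<^sup>+u. ennreal (w u * (q (t - u) - c)\<^sup>2) \<partial>lborel)"

lemma weighted_sq_error_measurable:
  fixes w q :: "real ^ 'p \<Rightarrow> real"
  assumes [measurable]: "w \<in> borel_measurable borel" "q \<in> borel_measurable borel"
    "h \<in> borel_measurable borel"
  shows "(\<lambda>t. weighted_sq_error w q t (h t)) \<in> borel_measurable borel"
  unfolding weighted_sq_error_def by measurable

lemma weighted_sq_error_decomposition:
  fixes w q :: "real ^ 'p \<Rightarrow> real"
  assumes [measurable]: "w \<in> borel_measurable borel" "q \<in> borel_measurable borel"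
    and "\<And>u. 0 \<le> w u" "integrable lborel w" "integrable lborel (\<lambda>u. q (t - u) * w u)"
    and "conv q w t = m * (\<integral>u. w u \<partial>lborel)"
  shows "weighted_sq_error w q t c =
    weighted_sq_error w q t m + ennreal ((\<integral>u. w u \<partial>lborel) * (m - c)\<^sup>2)"
  unfolding weighted_sq_error_def using assms
  by (intro nn_integral_sq_decomposition) (auto simp: conv_def)

section \<open>Densities and their convolution\<close>

lemma nn_integral_lborel_shift:
  fixes a :: "'a::euclidean_space"
  assumes [measurable]: "f \<in> borel_measurable borel"
  shows "(\<integral>\<^sup>+x. f (a + x) \<partial>lborel) = (\<integral>\<^sup>+x. f x \<partial>lborel)"
proof -
  have "(\<integral>\<^sup>+x. f x \<partial>distr lborel borel ((+) a)) = (\<integral>\<^sup>+x. f (a + x) \<partial>lborel)"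
    by (intro nn_integral_distr) auto
  then show ?thesis by (simp add: lborel_distr_plus)
qed

lemma nn_integral_lborel_reflect:
  fixes a :: "real ^ 'p"
  assumes [measurable]: "f \<in> borel_measurable borel"
  shows "(\<integral>\<^sup>+x. f (a - x) \<partial>lborel) = (\<integral>\<^sup>+x. f x \<partial>lborel)"
proof -
  have "(\<integral>\<^sup>+x. f x \<partial>distr lborel borel (\<lambda>x. a - x)) = (\<integral>\<^sup>+x. f (a - x) \<partial>lborel)"
    by (intro nn_integral_distr) auto
  then show ?thesis by (simp add: lborel_distr_reflect)
qed

lemma prob_densityD:
  assumes "prob_density f"
  shows "f \<in> borel_measurable borel" "\<And>t. 0 \<le> f t" "(\<integral>\<^sup>+t. ennreal (f t) \<partial>lborel) = 1"
    "integrable lborel f" "(\<integral>t. f t \<partial>lborel) = 1"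
proof -
  show [measurable]: "f \<in> borel_measurable borel" and nn: "\<And>t. 0 \<le> f t"
    and one: "(\<integral>\<^sup>+t. ennreal (f t) \<partial>lborel) = 1"
    using assms by (auto simp: prob_density_def)
  show "integrable lborel f"
    using nn one by (intro integrableI_nonneg) auto
  show "(\<integral>t. f t \<partial>lborel) = 1"
    using nn one by (subst integral_eq_nn_integral) auto
qed

lemma prob_density_uminus:
  fixes f :: "real ^ 'p \<Rightarrow> real"
  assumes "prob_density f"
  shows "prob_density (\<lambda>t. f (- t))"
proof -
  note [measurable] = prob_densityD(1)[OF assms]
  show ?thesis
    using nn_integral_lborel_reflect[of "\<lambda>t. ennreal (f t)" 0] prob_densityD[OF assms]
    by (simp add: prob_density_def)
qed

lemma prob_density_shift:
  fixes f :: "real ^ 'p \<Rightarrow> real"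
  assumes "prob_density f"
  shows "prob_density (\<lambda>t. f (t - a))"
proof -
  note [measurable] = prob_densityD(1)[OF assms]
  show ?thesis
    using nn_integral_lborel_shift[of "\<lambda>t. ennreal (f t)" "- a"] prob_densityD[OF assms]
    by (simp add: prob_density_def)
qed

lemma conv_measurable:
  fixes f g :: "real ^ 'p \<Rightarrow> real"
  assumes [measurable]: "f \<in> borel_measurable borel" "g \<in> borel_measurable borel"
  shows "conv f g \<in> borel_measurable borel"
  unfolding conv_def[abs_def] by measurable

text \<open>
  By Fubini \<open>f (t - u) * g u\<close> has total mass one on the product space. So for almost every \<open>t\<close> it is
  integrable in \<open>u\<close>. Elsewhere the Bochner integral \<open>conv f g t\<close> has the default value zero,
  which affects neither its sign nor its total mass.
\<close>

lemma
  fixes f g :: "real ^ 'p \<Rightarrow> real"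
  assumes f: "prob_density f" and g: "prob_density g"
  shows AE_integrable_conv: "AE t in lborel. integrable lborel (\<lambda>u. f (t - u) * g u)"
    and prob_density_conv: "prob_density (conv f g)"
proof -
  note [measurable] = prob_densityD(1)[OF f] prob_densityD(1)[OF g]
  have nn: "0 \<le> f t" "0 \<le> g t" for t
    using f g by (auto dest: prob_densityD)
  have "(\<integral>\<^sup>+t. \<integral>\<^sup>+u. ennreal (f (t - u) * g u) \<partial>lborel \<partial>lborel) =
      (\<integral>\<^sup>+u. \<integral>\<^sup>+t. ennreal (g u) * ennreal (f (t - u)) \<partial>lborel \<partial>lborel)"
    by (subst lborel_pair.Fubini') (auto simp: nn ennreal_mult mult.commute)
  also have "\<dots> = (\<integral>\<^sup>+u. ennreal (g u) \<partial>lborel)"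
    by (simp add: nn_integral_cmult prob_densityD(3)[OF prob_density_shift[OF f]])
  also have "\<dots> = 1" by (rule prob_densityD[OF g])
  finally have mass: "(\<integral>\<^sup>+t. \<integral>\<^sup>+u. ennreal (f (t - u) * g u) \<partial>lborel \<partial>lborel) = 1" .
  then have "AE t in lborel. (\<integral>\<^sup>+u. ennreal (f (t - u) * g u) \<partial>lborel) \<noteq> \<infinity>"
    by (intro nn_integral_PInf_AE) auto
  then show int: "AE t in lborel. integrable lborel (\<lambda>u. f (t - u) * g u)"
    by eventually_elim (intro integrableI_nonneg, auto simp: nn less_top)
  have "(\<integral>\<^sup>+t. ennreal (conv f g t) \<partial>lborel) =
      (\<integral>\<^sup>+t. \<integral>\<^sup>+u. ennreal (f (t - u) * g u) \<partial>lborel \<partial>lborel)"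
  proof (rule nn_integral_cong_AE)
    show "AE t in lborel. ennreal (conv f g t) = (\<integral>\<^sup>+u. ennreal (f (t - u) * g u) \<partial>lborel)"
      using int by eventually_elim (simp add: conv_def nn_integral_eq_integral nn)
  qed
  then show "prob_density (conv f g)"
    using mass conv_measurable[of f g] by (simp add: prob_density_def conv_def nn)
qed

lemma q_mre_estimator:
  fixes pX q :: "real ^ 'p \<Rightarrow> real"
  assumes "prob_density pX" "prob_density q"
  shows "predictive_density_estimator (q_mre q pX)" "equivariant (q_mre q pX)"
proof -
  have d: "prob_density (conv q (\<lambda>t. pX (- t)))"
    using assms by (intro prob_density_conv prob_density_uminus)
  note [measurable] = prob_densityD(1)[OF d]
  show "predictive_density_estimator (q_mre q pX)"
    unfolding predictive_density_estimator_def q_mre_def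
    using prob_density_shift[OF d] by auto
  show "equivariant (q_mre q pX)"
    by (simp add: equivariant_def q_mre_def)
qed

section \<open>The risk of an equivariant estimator\<close>

lemma risk_eq:
  fixes pX q :: "real ^ 'p \<Rightarrow> real"
  assumes model: "location_model M X Y pX q"
    and [measurable]: "q \<in> borel_measurable borel"
      "(\<lambda>(y, x). qhat y x) \<in> borel_measurable (borel \<Otimes>\<^sub>M borel)"
  shows "risk M X q \<mu> qhat = (\<integral>\<^sup>+x. ennreal (pX (x - \<mu>)) * L2_loss q \<mu> qhat x \<partial>lborel)"
proof -
  have "distributed (M \<mu>) lborel X (\<lambda>x. ennreal (pX (x - \<mu>)))"
    using model by (simp add: location_model_def)
  moreover have "L2_loss q \<mu> qhat \<in> borel_measurable lborel"
    unfolding L2_loss_def[abs_def] by measurable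
  ultimately show ?thesis
    unfolding risk_def by (rule distributed_nn_integral[symmetric])
qed

text \<open>
  The substitutions \<open>y = x + t\<close> and \<open>x = \<mu> - u\<close> remove \<open>\<mu>\<close>, which shows that the risk is constant;
  exchanging the integrals then leaves, for each \<open>t\<close>, a separate problem of approximating \<open>q (t - u)\<close>
  by the single number \<open>qhat t 0\<close>.
\<close>

lemma risk_equivariant:
  fixes pX q :: "real ^ 'p \<Rightarrow> real"
  assumes pX: "prob_density pX" and q: "prob_density q"
    and model: "location_model M X Y pX q"
    and est: "predictive_density_estimator qhat" and eqv: "equivariant qhat"
  shows "risk M X q \<mu> qhat =
    (\<integral>\<^sup>+t. weighted_sq_error (\<lambda>u. pX (- u)) q t (qhat t 0) \<partial>lborel)"
proof -
  note [measurable] = prob_densityD(1)[OF pX] prob_densityD(1)[OF q]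
  have meas[measurable]: "(\<lambda>(y, x). qhat y x) \<in> borel_measurable (borel \<Otimes>\<^sub>M borel)"
    and [measurable]: "(\<lambda>y. qhat y 0) \<in> borel_measurable borel"
    using est by (auto simp: predictive_density_estimator_def prob_density_def)
  have nn: "0 \<le> pX t" for t by (rule prob_densityD[OF pX])
  have loss: "L2_loss q \<mu> qhat x =
      (\<integral>\<^sup>+t. ennreal ((q (t + (x - \<mu>)) - qhat t 0)\<^sup>2) \<partial>lborel)" for x
  proof -
    have "L2_loss q \<mu> qhat x = (\<integral>\<^sup>+y. ennreal ((q (y - \<mu>) - qhat (y - x) 0)\<^sup>2) \<partial>lborel)"
      unfolding L2_loss_def using eqv by (metis equivariant_def)
    also have "\<dots> = (\<integral>\<^sup>+t. ennreal ((q (x + t - \<mu>) - qhat (x + t - x) 0)\<^sup>2) \<partial>lborel)"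
      by (subst nn_integral_lborel_shift[symmetric, of _ x]) auto
    finally show ?thesis by (simp add: algebra_simps)
  qed
  have "risk M X q \<mu> qhat = (\<integral>\<^sup>+x. ennreal (pX (x - \<mu>)) *
      (\<integral>\<^sup>+t. ennreal ((q (t + (x - \<mu>)) - qhat t 0)\<^sup>2) \<partial>lborel) \<partial>lborel)"
    by (simp add: risk_eq[OF model _ meas] loss)
  also have "\<dots> = (\<integral>\<^sup>+u. ennreal (pX (- u)) *
      (\<integral>\<^sup>+t. ennreal ((q (t - u) - qhat t 0)\<^sup>2) \<partial>lborel) \<partial>lborel)"
    by (subst nn_integral_lborel_reflect[symmetric, of _ \<mu>]) auto
  also have "\<dots> = (\<integral>\<^sup>+u. \<integral>\<^sup>+t. ennreal (pX (- u) * (q (t - u) - qhat t 0)\<^sup>2) \<partial>lborel \<partial>lborel)"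
    by (simp add: nn_integral_cmult ennreal_mult nn)
  also have "\<dots> = (\<integral>\<^sup>+t. \<integral>\<^sup>+u. ennreal (pX (- u) * (q (t - u) - qhat t 0)\<^sup>2) \<partial>lborel \<partial>lborel)"
    by (rule lborel_pair.Fubini') measurable
  finally show ?thesis by (simp add: weighted_sq_error_def)
qed

lemma risk_equivariant_decomposition:
  fixes pX q :: "real ^ 'p \<Rightarrow> real"
  assumes pX: "prob_density pX" and q: "prob_density q"
    and model: "location_model M X Y pX q"
    and est: "predictive_density_estimator qhat" and eqv: "equivariant qhat"
  shows "risk M X q \<mu> qhat = risk M X q \<mu> (q_mre q pX) +
    (\<integral>\<^sup>+t. ennreal ((q_mre q pX t 0 - qhat t 0)\<^sup>2) \<partial>lborel)"
proof -
  define w where "w = (\<lambda>u. pX (- u))"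
  have w: "prob_density w" unfolding w_def by (rule prob_density_uminus[OF pX])
  note [measurable] = prob_densityD(1)[OF w] prob_densityD(1)[OF q] conv_measurable
    weighted_sq_error_measurable
  have [measurable]: "(\<lambda>y. qhat y 0) \<in> borel_measurable borel"
    using est by (auto simp: predictive_density_estimator_def prob_density_def)
  have mre: "q_mre q pX t 0 = conv q w t" for t
    by (simp add: q_mre_def w_def)
  have "AE t in lborel. weighted_sq_error w q t (qhat t 0) =
      weighted_sq_error w q t (conv q w t) + ennreal ((conv q w t - qhat t 0)\<^sup>2)"
    using AE_integrable_conv[OF q w]
  proof eventually_elim
    case (elim t)
    then show ?case
      using weighted_sq_error_decomposition[of w q t "conv q w t" "qhat t 0"]
        prob_densityD[OF w] prob_densityD[OF q] by simp
  qed
  then have "(\<integral>\<^sup>+t. weighted_sq_error w q t (qhat t 0) \<partial>lborel) =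
      (\<integral>\<^sup>+t. weighted_sq_error w q t (conv q w t) + ennreal ((conv q w t - qhat t 0)\<^sup>2) \<partial>lborel)"
    by (rule nn_integral_cong_AE)
  also have "\<dots> = (\<integral>\<^sup>+t. weighted_sq_error w q t (conv q w t) \<partial>lborel) +
      (\<integral>\<^sup>+t. ennreal ((conv q w t - qhat t 0)\<^sup>2) \<partial>lborel)"
    by (rule nn_integral_add) auto
  finally show ?thesis
    using risk_equivariant[OF pX q model est eqv, of \<mu>]
      risk_equivariant[OF pX q model q_mre_estimator[OF pX q], of \<mu>]
    by (simp add: w_def[symmetric] mre)
qed

section \<open>A lower bound for the maximal risk of any estimator\<close>

text \<open>
  The right-hand side bounds the integral of the risk over \<open>\<mu>\<close> in the ball of radius \<open>r + k\<close>. In that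
  integral the order is changed so that \<open>x\<close> and \<open>t = y - x\<close> are fixed and \<open>u = \<mu> - x\<close> is integrated
  first: there the estimator is again a single number, to which \<open>V t\<close> is a lower bound. Keeping only
  \<open>norm x < r\<close> and \<open>norm u < k\<close> makes the bound the same for all remaining \<open>x\<close>.
\<close>

lemma averaged_risk_lower_bound:
  fixes pX q :: "real ^ 'p \<Rightarrow> real"
  assumes pX: "prob_density pX" and q: "prob_density q"
    and model: "location_model M X Y pX q"
    and est: "predictive_density_estimator qhat"
    and pointwise: "AE t in lborel.
      \<forall>d. V t \<le> weighted_sq_error (\<lambda>u. indicator (ball 0 k) u * pX (- u)) q t d"
    and [measurable]: "V \<in> borel_measurable borel"
  shows "emeasure lborel (ball (0::real^'p) r) * (\<integral>\<^sup>+t. V t \<partial>lborel) \<le>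
    emeasure lborel (ball (0::real^'p) (r + k)) * (SUP \<mu>. risk M X q \<mu> qhat)"
proof -
  note [measurable] = prob_densityD(1)[OF pX] prob_densityD(1)[OF q]
  have meas[measurable]: "(\<lambda>(y, x). qhat y x) \<in> borel_measurable (borel \<Otimes>\<^sub>M borel)"
    using est by (auto simp: predictive_density_estimator_def)
  have nn: "0 \<le> pX t" for t by (rule prob_densityD[OF pX])
  let ?B = "ball (0::real^'p)"
  have [measurable]: "?B s \<in> sets borel" for s by simp
  let ?F = "\<lambda>x u t. ennreal (indicator (?B (r + k)) (x + u) *
              (pX (- u) * (q (t - u) - qhat (x + t) x)\<^sup>2))"
  have loss: "L2_loss q \<mu> qhat x =
      (\<integral>\<^sup>+t. ennreal ((q (x + t - \<mu>) - qhat (x + t) x)\<^sup>2) \<partial>lborel)" for x \<mu>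
    unfolding L2_loss_def by (subst nn_integral_lborel_shift[symmetric, of _ x]) auto
  \<comment> \<open>The contribution of a single observation \<open>x\<close> to the integrated risk.\<close>
  have for_x: "indicator (?B r) x * (\<integral>\<^sup>+t. V t \<partial>lborel) \<le>
      (\<integral>\<^sup>+\<mu>. indicator (?B (r + k)) \<mu> * (ennreal (pX (x - \<mu>)) * L2_loss q \<mu> qhat x) \<partial>lborel)"
    for x
  proof -
    have "indicator (?B r) x * (\<integral>\<^sup>+t. V t \<partial>lborel) \<le> (\<integral>\<^sup>+t. \<integral>\<^sup>+u. ?F x u t \<partial>lborel \<partial>lborel)"
    proof (cases "x \<in> ?B r")
      case True
      have le: "weighted_sq_error (\<lambda>u. indicator (?B k) u * pX (- u)) q t (qhat (x + t) x)
          \<le> (\<integral>\<^sup>+u. ?F x u t \<partial>lborel)" for t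
        unfolding weighted_sq_error_def
      proof (intro nn_integral_mono ennreal_leI)
        fix u
        have "norm (x + u) < r + k" if "norm u < k"
          using True that norm_triangle_ineq[of x u] by simp
        then have "indicator (?B k) u \<le> (indicator (?B (r + k)) (x + u) :: real)"
          by (auto simp: indicator_def)
        then show "indicator (?B k) u * pX (- u) * (q (t - u) - qhat (x + t) x)\<^sup>2
            \<le> indicator (?B (r + k)) (x + u) * (pX (- u) * (q (t - u) - qhat (x + t) x)\<^sup>2)"
          by (simp add: mult_right_mono nn mult.assoc)
      qed
      have "(\<integral>\<^sup>+t. V t \<partial>lborel) \<le> (\<integral>\<^sup>+t. \<integral>\<^sup>+u. ?F x u t \<partial>lborel \<partial>lborel)"
        using pointwise by (intro nn_integral_mono_AE, eventually_elim)
          (blast intro: order_trans le)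
      then show ?thesis using True by simp
    qed simp
    also have "\<dots> = (\<integral>\<^sup>+u. \<integral>\<^sup>+t. ?F x u t \<partial>lborel \<partial>lborel)"
      by (rule lborel_pair.Fubini') measurable
    also have "\<dots> = (\<integral>\<^sup>+u. indicator (?B (r + k)) (x + u) *
        (ennreal (pX (x - (x + u))) * L2_loss q (x + u) qhat x) \<partial>lborel)"
      unfolding loss
      by (simp add: nn_integral_cmult ennreal_mult nn ennreal_indicator)
    also have "\<dots> = (\<integral>\<^sup>+\<mu>. indicator (?B (r + k)) \<mu> *
        (ennreal (pX (x - \<mu>)) * L2_loss q \<mu> qhat x) \<partial>lborel)"
      unfolding L2_loss_def
      by (rule nn_integral_lborel_shift[where f = "\<lambda>\<mu>. indicator (?B (r + k)) \<mu> *
        (ennreal (pX (x - \<mu>)) * (\<integral>\<^sup>+y. ennreal ((q (y - \<mu>) - qhat y x)\<^sup>2) \<partial>lborel))"])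
        measurable
    finally show ?thesis .
  qed
  have "emeasure lborel (?B r) * (\<integral>\<^sup>+t. V t \<partial>lborel) =
      (\<integral>\<^sup>+x. indicator (?B r) x * (\<integral>\<^sup>+t. V t \<partial>lborel) \<partial>lborel)"
    by (simp add: nn_integral_multc)
  also have "\<dots> \<le> (\<integral>\<^sup>+x. \<integral>\<^sup>+\<mu>. indicator (?B (r + k)) \<mu> *
      (ennreal (pX (x - \<mu>)) * L2_loss q \<mu> qhat x) \<partial>lborel \<partial>lborel)"
    by (intro nn_integral_mono for_x)
  also have "\<dots> = (\<integral>\<^sup>+\<mu>. \<integral>\<^sup>+x. indicator (?B (r + k)) \<mu> *
      (ennreal (pX (x - \<mu>)) * L2_loss q \<mu> qhat x) \<partial>lborel \<partial>lborel)"
    unfolding L2_loss_def by (rule lborel_pair.Fubini') measurable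
  also have "\<dots> = (\<integral>\<^sup>+\<mu>. indicator (?B (r + k)) \<mu> * risk M X q \<mu> qhat \<partial>lborel)"
    unfolding risk_eq[OF model prob_densityD(1)[OF q] meas]
    unfolding L2_loss_def by (intro nn_integral_cong nn_integral_cmult) measurable
  also have "\<dots> \<le> (\<integral>\<^sup>+\<mu>. indicator (?B (r + k)) \<mu> * (SUP \<mu>. risk M X q \<mu> qhat) \<partial>lborel)"
    by (intro nn_integral_mono mult_left_mono SUP_upper) auto
  also have "\<dots> = emeasure lborel (?B (r + k)) * (SUP \<mu>. risk M X q \<mu> qhat)"
    by (simp add: nn_integral_multc)
  finally show ?thesis .
qed

text \<open>
  The two volumes have ratio \<open>(r / (r + k)) ^ d\<close>, \<open>d\<close> being the dimension, which tends to one: the boundary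
  layer of fixed width \<open>k\<close> is negligible. In the limit \<open>W\<close> may be infinite, because the factor
  tends to one and not to zero.
\<close>

lemma le_of_ball_emeasure_le:
  assumes k: "0 \<le> k"
    and le: "\<And>r. 0 < r \<Longrightarrow> emeasure lborel (ball (0::'a::euclidean_space) r) * W \<le>
      emeasure lborel (ball (0::'a) (r + k)) * S"
  shows "W \<le> S"
proof -
  let ?d = "DIM('a)"
  let ?v = "unit_ball_vol (real ?d)"
  have v: "?v \<noteq> 0" by (rule less_imp_neq[THEN not_sym]) simp
  have "ennreal ((real n / (real n + k)) ^ ?d) * W \<le> S" if n: "0 < n" for n :: nat
  proof -
    have pos: "0 < ?v * (real n + k) ^ ?d" using n k by simp
    have "ennreal (?v * real n ^ ?d) * W \<le> ennreal (?v * (real n + k) ^ ?d) * S"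
      using le[of "real n"] n k by (simp add: emeasure_ball)
    then have "ennreal (1 / (?v * (real n + k) ^ ?d)) * (ennreal (?v * real n ^ ?d) * W) \<le>
        ennreal (1 / (?v * (real n + k) ^ ?d)) * (ennreal (?v * (real n + k) ^ ?d) * S)"
      by (rule mult_left_mono) simp
    moreover have "1 / (?v * (real n + k) ^ ?d) * (?v * real n ^ ?d) = (real n / (real n + k)) ^ ?d"
      using n k v by (simp add: power_divide)
    moreover have "1 / (?v * (real n + k) ^ ?d) * (?v * (real n + k) ^ ?d) = 1"
      using pos by (metis nonzero_eq_divide_eq order_less_irrefl)
    ultimately show ?thesis
      using pos by (simp add: mult.assoc[symmetric] ennreal_mult[symmetric])
  qed
  note bound = this
  have ev: "eventually (\<lambda>n. ennreal ((real n / (real n + k)) ^ ?d) * W \<le> S) sequentially"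
    using eventually_gt_at_top[of "0::nat"] by eventually_elim (rule bound)
  have "(\<lambda>n. real n / (real n + k)) \<longlonglongrightarrow> 1"
    by real_asymp
  then have "(\<lambda>n. ennreal ((real n / (real n + k)) ^ ?d) * W) \<longlonglongrightarrow> ennreal (1 ^ ?d) * W"
    by (intro tendsto_mult_ennreal tendsto_ennrealI tendsto_power tendsto_const) auto
  then show ?thesis
    using ev by (intro tendsto_upperbound[of _ W]) auto
qed

text \<open>
  Truncation to the ball of radius \<open>k\<close> changes both the weight and the optimal constant. By dominated
  convergence the mass tends to one and the weighted mean to \<open>conv q w t\<close>, so the integrands converge
  pointwise and Fatou's lemma applies, even when the limiting error is infinite.
\<close>

lemma truncated_sq_error_liminf:
  fixes w q :: "real ^ 'p \<Rightarrow> real"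
  assumes w: "prob_density w" and [measurable]: "q \<in> borel_measurable borel"
    and int: "integrable lborel (\<lambda>u. q (t - u) * w u)"
  defines "wk \<equiv> \<lambda>k::nat. \<lambda>u. indicator (ball 0 (real k)) u * w u"
  shows "weighted_sq_error w q t (conv q w t) \<le>
    liminf (\<lambda>k. weighted_sq_error (wk k) q t (conv q (wk k) t / (\<integral>u. wk k u \<partial>lborel)))"
proof -
  note [measurable] = prob_densityD(1)[OF w]
  have [measurable]: "ball (0::real^'p) s \<in> sets borel" for s by simp
  have [measurable]: "wk k \<in> borel_measurable borel" for k
    unfolding wk_def by measurable
  have lim_w: "(\<lambda>k. wk k u) \<longlonglongrightarrow> w u" for u
  proof (rule tendsto_eventually)
    obtain K :: nat where "norm u < real K" using reals_Archimedean2 by blast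
    then show "eventually (\<lambda>k. wk k u = w u) sequentially"
      unfolding wk_def by (intro eventually_sequentiallyI[of K]) (auto simp: indicator_def)
  qed
  have wk_le: "norm (wk k u) \<le> w u" "norm (q (t - u) * wk k u) \<le> norm (q (t - u) * w u)" for k u
    using prob_densityD(2)[OF w] by (auto simp: wk_def indicator_def)
  have "(\<lambda>k. \<integral>u. wk k u \<partial>lborel) \<longlonglongrightarrow> (\<integral>u. w u \<partial>lborel)"
    by (rule integral_dominated_convergence[where w = w])
      (use prob_densityD[OF w] lim_w wk_le in auto)
  then have "(\<lambda>k. \<integral>u. wk k u \<partial>lborel) \<longlonglongrightarrow> 1"
    by (simp add: prob_densityD[OF w])
  moreover have "(\<lambda>k. conv q (wk k) t) \<longlonglongrightarrow> conv q w t"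
    unfolding conv_def
    by (rule integral_dominated_convergence[where w = "\<lambda>u. norm (q (t - u) * w u)"])
      (use int lim_w wk_le in \<open>auto intro!: tendsto_intros\<close>)
  ultimately have "(\<lambda>k. conv q (wk k) t / (\<integral>u. wk k u \<partial>lborel)) \<longlonglongrightarrow> conv q w t / 1"
    by (intro tendsto_divide) auto
  then have "(\<lambda>k. ennreal (wk k u * (q (t - u) - conv q (wk k) t / (\<integral>u. wk k u \<partial>lborel))\<^sup>2))
      \<longlonglongrightarrow> ennreal (w u * (q (t - u) - conv q w t)\<^sup>2)" for u
    using lim_w by (intro tendsto_ennrealI tendsto_intros) auto
  then have "weighted_sq_error w q t (conv q w t) = (\<integral>\<^sup>+u. liminf (\<lambda>k.
      ennreal (wk k u * (q (t - u) - conv q (wk k) t / (\<integral>u. wk k u \<partial>lborel))\<^sup>2)) \<partial>lborel)"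
    unfolding weighted_sq_error_def
    by (intro nn_integral_cong lim_imp_Liminf[symmetric]) auto
  then show ?thesis
    unfolding weighted_sq_error_def by (simp add: nn_integral_liminf)
qed

text \<open>
  The functions \<open>V k\<close> below are the least mean square errors for the truncated weights. Each has integral
  at most the maximal risk of \<open>qhat\<close>; Fatou's lemma in \<open>t\<close>, after the one in \<open>u\<close>, passes this bound on to
  the error for the full weight.
\<close>

lemma risk_q_mre_le_sup_risk:
  fixes pX q :: "real ^ 'p \<Rightarrow> real"
  assumes pX: "prob_density pX" and q: "prob_density q"
    and model: "location_model M X Y pX q"
    and est: "predictive_density_estimator qhat"
  shows "risk M X q \<mu> (q_mre q pX) \<le> (SUP \<mu>. risk M X q \<mu> qhat)"
proof -
  define w where "w = (\<lambda>u. pX (- u))"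
  define wk where "wk = (\<lambda>k::nat. \<lambda>u. indicator (ball 0 (real k)) u * w u)"
  define V where "V = (\<lambda>k t.
    weighted_sq_error (wk k) q t (conv q (wk k) t / (\<integral>u. wk k u \<partial>lborel)))"
  have w: "prob_density w" unfolding w_def by (rule prob_density_uminus[OF pX])
  note [measurable] = prob_densityD(1)[OF w] prob_densityD(1)[OF q] conv_measurable
    weighted_sq_error_measurable
  have [measurable]: "ball (0::real^'p) s \<in> sets borel" for s by simp
  have [measurable]: "wk k \<in> borel_measurable borel" for k
    unfolding wk_def by measurable
  have [measurable]: "V k \<in> borel_measurable borel" for k
    unfolding V_def by measurable
  have wk_nn: "0 \<le> wk k u" for k u
    using prob_densityD(2)[OF w] by (auto simp: wk_def indicator_def)
  have abs_wk: "\<bar>wk k u\<bar> \<le> \<bar>w u\<bar>" for k u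
    by (simp add: wk_def indicator_def)
  have int_wk: "integrable lborel (wk k)" for k
    using prob_densityD(4)[OF w] by (rule Bochner_Integration.integrable_bound)
      (use abs_wk in auto)
  have V_le: "AE t in lborel. \<forall>d. V k t \<le> weighted_sq_error (wk k) q t d" for k
    using AE_integrable_conv[OF q w]
  proof eventually_elim
    case (elim t)
    have int: "integrable lborel (\<lambda>u. q (t - u) * wk k u)"
      using elim by (rule Bochner_Integration.integrable_bound)
        (use abs_wk in \<open>auto intro!: mult_left_mono simp: abs_mult\<close>)
    \<comment> \<open>The ball may carry no mass; then \<open>x / 0 = 0\<close> must still be a weighted mean.\<close>
    have "conv q (wk k) t = 0" if "(\<integral>u. wk k u \<partial>lborel) = 0"
    proof -
      have "AE u in lborel. wk k u = 0"
        using that integral_nonneg_eq_0_iff_AE[OF int_wk] wk_nn by simp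
      then have "conv q (wk k) t = (\<integral>u. 0 \<partial>(lborel :: (real^'p) measure))"
        unfolding conv_def by (intro integral_cong_AE) auto
      then show ?thesis by simp
    qed
    then have mean: "conv q (wk k) t =
        conv q (wk k) t / (\<integral>u. wk k u \<partial>lborel) * (\<integral>u. wk k u \<partial>lborel)"
      by auto
    have "V k t \<le> weighted_sq_error (wk k) q t d" for d
      using weighted_sq_error_decomposition[OF _ _ wk_nn int_wk int mean, of d] by (simp add: V_def)
    then show ?case by simp
  qed
  have V_bound: "(\<integral>\<^sup>+t. V k t \<partial>lborel) \<le> (SUP \<mu>. risk M X q \<mu> qhat)" for k
  proof (rule le_of_ball_emeasure_le[where 'a = "real^'p" and k = "real k"])
    show "emeasure lborel (ball (0::real^'p) r) * (\<integral>\<^sup>+t. V k t \<partial>lborel) \<le>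
        emeasure lborel (ball (0::real^'p) (r + real k)) * (SUP \<mu>. risk M X q \<mu> qhat)" for r
      using V_le[of k] unfolding wk_def w_def
      by (rule averaged_risk_lower_bound[OF pX q model est]) measurable
  qed simp
  have "risk M X q \<mu> (q_mre q pX) = (\<integral>\<^sup>+t. weighted_sq_error w q t (conv q w t) \<partial>lborel)"
    using risk_equivariant[OF pX q model q_mre_estimator[OF pX q]]
    by (simp add: q_mre_def w_def)
  also have "\<dots> \<le> (\<integral>\<^sup>+t. liminf (\<lambda>k. V k t) \<partial>lborel)"
  proof (rule nn_integral_mono_AE)
    show "AE t in lborel. weighted_sq_error w q t (conv q w t) \<le> liminf (\<lambda>k. V k t)"
      using AE_integrable_conv[OF q w]
      by eventually_elim (simp add: V_def wk_def truncated_sq_error_liminf[OF w])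
  qed
  also have "\<dots> \<le> liminf (\<lambda>k. \<integral>\<^sup>+t. V k t \<partial>lborel)"
    by (rule nn_integral_liminf) auto
  also have "\<dots> \<le> (SUP \<mu>. risk M X q \<mu> qhat)"
    by (rule Liminf_le) (auto simp: V_bound)
  finally show ?thesis .
qed

section \<open>Minimum risk equivariance and minimaxity\<close>

theorem proposition2p1:
  fixes pX q :: "real ^ 'p \<Rightarrow> real"
    and M :: "real ^ 'p \<Rightarrow> 'w measure"
    and X Y :: "'w \<Rightarrow> real ^ 'p"
  assumes "prob_density pX" and "prob_density q"
    and "location_model M X Y pX q"
  shows "min_risk_equivariant M X q (q_mre q pX) \<and>
    (\<forall>qhat. min_risk_equivariant M X q qhat \<and> (\<forall>\<mu>. risk M X q \<mu> qhat < \<infinity>) \<longrightarrow>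
       (\<forall>x. AE y in lborel. qhat y x = q_mre q pX y x)) \<and>
    (\<forall>x y. q_mre q pX y x = bayes_predictive q (posterior (\<lambda>_. 1) pX) y x) \<and>
    minimax M X q (q_mre q pX)"
proof (intro conjI allI impI)
  note est = q_mre_estimator[OF assms(1,2)]
  note decomp = risk_equivariant_decomposition[OF assms]
  note [measurable] = prob_densityD(1)[OF assms(1)] prob_densityD(1)[OF assms(2)]
  show mre: "min_risk_equivariant M X q (q_mre q pX)"
    unfolding min_risk_equivariant_def
  proof (intro conjI allI impI est)
    fix qhat :: "real ^ 'p \<Rightarrow> real ^ 'p \<Rightarrow> real" and \<mu>
    assume "predictive_density_estimator qhat \<and> equivariant qhat"
    then show "risk M X q \<mu> (q_mre q pX) \<le> risk M X q \<mu> qhat"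
      by (subst decomp[of qhat]) auto
  qed
  show "minimax M X q (q_mre q pX)"
    unfolding minimax_def
    using est risk_q_mre_le_sup_risk[OF assms] by (auto intro: SUP_least)
  show "q_mre q pX y x = bayes_predictive q (posterior (\<lambda>_. 1) pX) y x" for x y
  proof -
    have "(\<integral>\<mu>. q (y - \<mu>) * pX (x - \<mu>) \<partial>distr lborel borel ((+) x)) =
        (\<integral>u. q (y - (x + u)) * pX (x - (x + u)) \<partial>lborel)"
      by (intro integral_distr) auto
    then show ?thesis
      by (simp add: q_mre_def conv_def bayes_predictive_def posterior_uniform[OF assms(1)]
          lborel_distr_plus diff_diff_eq)
  qed
  fix qhat x
  assume qhat: "min_risk_equivariant M X q qhat \<and> (\<forall>\<mu>. risk M X q \<mu> qhat < \<infinity>)"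
  then have est': "predictive_density_estimator qhat" "equivariant qhat"
    by (auto simp: min_risk_equivariant_def)
  have [measurable]: "(\<lambda>t. qhat t 0) \<in> borel_measurable borel"
    "(\<lambda>t. q_mre q pX t 0) \<in> borel_measurable borel"
    using est est' by (auto simp: predictive_density_estimator_def prob_density_def)
  let ?R = "risk M X q 0 (q_mre q pX)"
  let ?D = "\<integral>\<^sup>+t. ennreal ((q_mre q pX t 0 - qhat t 0)\<^sup>2) \<partial>lborel"
  have "risk M X q 0 qhat \<le> ?R"
    using qhat est by (auto simp: min_risk_equivariant_def)
  \<comment> \<open>Cancelling \<open>?R\<close> is where finiteness of the risk is essential.\<close>
  then have "?R + ?D \<le> ?R + 0"
    by (subst (asm) decomp[OF est', of 0]) simp
  moreover have "?R \<noteq> \<infinity>"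
    using qhat mre est' unfolding min_risk_equivariant_def
    by (metis infinity_ennreal_def leD)
  ultimately have "?D = 0"
    unfolding ennreal_add_left_cancel_le by simp
  then have "AE t in lborel. qhat t 0 = q_mre q pX t 0"
    by (subst (asm) nn_integral_0_iff_AE) auto
  then have "AE t in distr lborel borel ((+) (- x)). qhat t 0 = q_mre q pX t 0"
    unfolding lborel_distr_plus .
  then have "AE y in lborel. qhat (- x + y) 0 = q_mre q pX (- x + y) 0"
    by (subst (asm) AE_distr_iff) auto
  moreover have "qhat y x = qhat (- x + y) 0" "q_mre q pX y x = q_mre q pX (- x + y) 0" for y
    using est(2) est'(2) unfolding equivariant_def by (metis uminus_add_conv_diff)+
  ultimately show "AE y in lborel. qhat y x = q_mre q pX y x"
    by simp
qed

end
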